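(* Let $d\ge 2$ be an integer. Every CIS $d$-graph $\mathcal{G}$ has a unique canonical modular decomposition whose factors are CIS $d$-graphs using at most two colors. That is, for every CIS $d$-graph $\mathcal{G}$, the strong modules of $\mathcal{G}$ form a (uniquely determined) rooted tree under inclusion, the canonical modular decomposition tree, and for every internal node $M$ of this tree the quotient $d$-graph $Q_M$ is a CIS $d$-graph whose edge-coloring uses at most two colors.
   Context: All graphs are finite and simple, and maximality is with respect to inclusion. For a graph $H=(W,F)$, a set $S\subseteq W$ is stable (independent) if no edge of $F$ has both ends in $S$. For an integer $d\ge 2$, write $[d]=\{1,\ldots,d\}$. A $d$-graph is a pair $\mathcal{G}=(V;\varphi)$, where $V$ is a finite vertex set and $\varphi:\binom{V}{2}\to[d]$ is a coloring of the edges of the complete graph on $V$; not every color need be used. For $i\in[d]$, the $i$-th chromatic component is the graph $G_i=(V,E_i)$ with $E_i=\varphi^{-1}(i)$. The $d$-graph $\mathcal{G}$ is CIS if for every choice of a maximal stable set $S_i$ of $G_i$, one for each $i\in[d]$, one has $\bigcap_{i=1}^d S_i\neq\varnothing$. A nonempty set $M\subseteq V$ is a module of $\mathcal{G}=(V;\varphi)$ if, for every $x\in V\setminus M$, the color $\varphi(xu)$ is independent of $u\in M$. Two sets overlap if they intersect but neither contains the other. A module is strong if it overlaps no other module. The strong modules form a unique rooted tree under inclusion, with root $V$ and with the singletons as leaves; this is the canonical modular decomposition tree. If $M$ is an internal node (a strong module that is not a singleton), its children (the maximal strong modules properly contained in $M$) partition $M$, and all edges between any two distinct children have the same color. The quotient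 $d$-graph $Q_M$ has the children of $M$ as vertices, the edge joining two children being given the common color of all edges of $\mathcal{G}$ between them. The quotients $Q_M$, over all internal nodes $M$, are the factors of the canonical modular decomposition. *)

theory Defs
  imports Main "HOL-Library.Disjoint_Sets"
begin

definition pairs :: "'a set \<Rightarrow> 'a set set" where
  "pairs V = {e. e \<subseteq> V \<and> card e = 2}"

definition stable :: "'a set \<Rightarrow> 'a set set \<Rightarrow> 'a set \<Rightarrow> bool" where
  "stable W F S \<longleftrightarrow> S \<subseteq> W \<and> (\<forall>e\<in>F. \<not> e \<subseteq> S)"

definition maximal_stable :: "'a set \<Rightarrow> 'a set set \<Rightarrow> 'a set \<Rightarrow> bool" where
  "maximal_stable W F S \<longleftrightarrow> stable W F S \<and> (\<forall>T. stable W F T \<longrightarrow> \<not> S \<subset> T)"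

text \<open>Colorings are total functions on sets; only the values on \<open>pairs V\<close> matter.\<close>

definition d_graph :: "nat \<Rightarrow> 'a set \<Rightarrow> ('a set \<Rightarrow> nat) \<Rightarrow> bool" where
  "d_graph d V \<phi> \<longleftrightarrow> finite V \<and> \<phi> ` pairs V \<subseteq> {1..d}"

definition chromatic_component :: "'a set \<Rightarrow> ('a set \<Rightarrow> nat) \<Rightarrow> nat \<Rightarrow> 'a set set" where
  "chromatic_component V \<phi> i = {e \<in> pairs V. \<phi> e = i}"

definition cis_d_graph :: "nat \<Rightarrow> 'a set \<Rightarrow> ('a set \<Rightarrow> nat) \<Rightarrow> bool" where
  "cis_d_graph d V \<phi> \<longleftrightarrow> d_graph d V \<phi> \<and>
     (\<forall>S. (\<forall>i\<in>{1..d}. maximal_stable V (chromatic_component V \<phi> i) (S i))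
        \<longrightarrow> (\<Inter>i\<in>{1..d}. S i) \<noteq> {})"

definition colors_used :: "'a set \<Rightarrow> ('a set \<Rightarrow> nat) \<Rightarrow> nat set" where
  "colors_used V \<phi> = \<phi> ` pairs V"

definition is_module :: "'a set \<Rightarrow> ('a set \<Rightarrow> nat) \<Rightarrow> 'a set \<Rightarrow> bool" where
  "is_module V \<phi> M \<longleftrightarrow> M \<noteq> {} \<and> M \<subseteq> V \<and>
     (\<forall>x\<in>V - M. \<forall>u\<in>M. \<forall>v\<in>M. \<phi> {x, u} = \<phi> {x, v})"

definition overlap :: "'a set \<Rightarrow> 'a set \<Rightarrow> bool" where
  "overlap A B \<longleftrightarrow> A \<inter> B \<noteq> {} \<and> \<not> A \<subseteq> B \<and> \<not> B \<subseteq> A"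

definition strong_module :: "'a set \<Rightarrow> ('a set \<Rightarrow> nat) \<Rightarrow> 'a set \<Rightarrow> bool" where
  "strong_module V \<phi> M \<longleftrightarrow> is_module V \<phi> M \<and> (\<forall>N. is_module V \<phi> N \<longrightarrow> \<not> overlap M N)"

definition children :: "'a set \<Rightarrow> ('a set \<Rightarrow> nat) \<Rightarrow> 'a set \<Rightarrow> 'a set set" where
  "children V \<phi> M = {C. strong_module V \<phi> C \<and> C \<subset> M \<and>
     (\<forall>D. strong_module V \<phi> D \<and> D \<subset> M \<longrightarrow> \<not> C \<subset> D)}"

text \<open>The quotient has the elements of \<open>children V \<phi> M\<close> as vertices. The color of a pair
  of disjoint vertex sets is the common color of all edges between them; it is
  unspecified when there is no such common color.\<close>

definition quotient_coloring :: "('a set \<Rightarrow> nat) \<Rightarrow> 'a set set \<Rightarrow> nat" where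
  "quotient_coloring \<phi> e =
     (THE c. \<forall>A\<in>e. \<forall>B\<in>e. A \<noteq> B \<longrightarrow> (\<forall>a\<in>A. \<forall>b\<in>B. \<phi> {a, b} = c))"

record 'v tree =
  nodes :: "'v set"
  root :: "'v"
  arcs :: "('v \<times> 'v) set"

text \<open>Arcs are directed from parent to child.\<close>

definition rooted_tree :: "'v tree \<Rightarrow> bool" where
  "rooted_tree T \<longleftrightarrow> finite (nodes T) \<and> root T \<in> nodes T \<and> arcs T \<subseteq> nodes T \<times> nodes T \<and>
     (\<forall>x\<in>nodes T. (root T, x) \<in> (arcs T)\<^sup>*) \<and>
     (\<forall>x. (x, root T) \<notin> arcs T) \<and>
     (\<forall>x\<in>nodes T - {root T}. \<exists>!p. (p, x) \<in> arcs T)"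

definition leaves :: "'v tree \<Rightarrow> 'v set" where
  "leaves T = {x \<in> nodes T. arcs T `` {x} = {}}"

text \<open>A tree of sets under inclusion: being an ancestor is the same as being a superset.\<close>

definition inclusion_tree :: "'a set tree \<Rightarrow> bool" where
  "inclusion_tree T \<longleftrightarrow> rooted_tree T \<and>
     (\<forall>X\<in>nodes T. \<forall>Y\<in>nodes T. (X, Y) \<in> (arcs T)\<^sup>* \<longleftrightarrow> Y \<subseteq> X)"

definition canonical_decomposition_tree ::
    "'a set \<Rightarrow> ('a set \<Rightarrow> nat) \<Rightarrow> 'a set tree \<Rightarrow> bool" where
  "canonical_decomposition_tree V \<phi> T \<longleftrightarrow>
     inclusion_tree T \<and> nodes T = {M. strong_module V \<phi> M}"

end

theory Submission
  imports Defs
begin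

text \<open>
  The heart of the matter is that a CIS \<open>d\<close>-graph contains no rainbow triangle, that is, no
  triangle whose three edges have three different colors (\<open>cis_rainbow_free\<close>). The CIS property
  says that any family of sets \<open>A\<^sub>i\<close>, each free of color \<open>i\<close>, can be enlarged by one common vertex.
  In this form it is clear that it survives deleting the \<open>i\<close>-neighbours of a vertex \<open>a\<close>: put \<open>a\<close>
  into \<open>A\<^sub>i\<close>, and the common vertex is forced to be among the remaining ones. In a smallest CIS
  \<open>d\<close>-graph with a rainbow triangle such a deletion must destroy every rainbow triangle, so a vertex
  of a rainbow triangle is incident only with the two colors that it has inside the triangle. The
  CIS property now yields a vertex \<open>p\<close> joined to the corners \<open>a\<close>, \<open>b\<close>, \<open>c\<close> in the colors of
  \<open>ab\<close>, \<open>bc\<close>, \<open>ca\<close>, and a vertex \<open>q\<close> joined to them in the colors of \<open>ca\<close>, \<open>ab\<close>, \<open>bc\<close>.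
  Whatever the color of \<open>pq\<close> is, one vertex of the triangle forms with \<open>p\<close> and \<open>q\<close> another
  rainbow triangle, although three colors occur at \<open>p\<close>. This is a contradiction.

  The quotient of a CIS \<open>d\<close>-graph by a partition of a module into modules is CIS again, because
  color-free sets of blocks lift to color-free sets of representatives (\<open>cis_quotient\<close>). Hence the
  quotients \<open>Q\<^sub>M\<close> have no rainbow triangle, and Gallai's structure theory applies to them. Without
  rainbow triangles the components of a single color are modules. The union of the children in such
  a component of \<open>Q\<^sub>M\<close> is even a strong module of the whole graph
  (\<open>color_component_of_children_strong\<close>), and since nothing strong lies strictly between \<open>M\<close> and
  its children, every color that occurs in \<open>Q\<^sub>M\<close> connects all of \<open>Q\<^sub>M\<close>. On the other hand three
  colors cannot all be connected when there is no rainbow triangle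
  (\<open>rainbow_free_two_connected_colors\<close>), so at most two colors occur.

  The tree itself only depends on the strong modules being a laminar family: in a tree whose
  ancestor relation is inclusion the arcs are exactly the covering pairs
  (\<open>canonical_decomposition_tree_iff\<close>).
\<close>

section \<open>The CIS property as a common extension property\<close>

definition avoids :: "('a set \<Rightarrow> nat) \<Rightarrow> nat \<Rightarrow> 'a set \<Rightarrow> bool" where
  "avoids \<phi> i S \<longleftrightarrow> (\<forall>u\<in>S. \<forall>v\<in>S. u \<noteq> v \<longrightarrow> \<phi> {u, v} \<noteq> i)"

text \<open>
  Three pairwise different colors force the three vertices to be distinct: if two vertices
  coincide, then so do two of the three pairs.
\<close>

definition rainbow :: "('a set \<Rightarrow> nat) \<Rightarrow> 'a \<Rightarrow> 'a \<Rightarrow> 'a \<Rightarrow> bool" where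
  "rainbow \<phi> a b c \<longleftrightarrow>
     \<phi> {a, b} \<noteq> \<phi> {b, c} \<and> \<phi> {b, c} \<noteq> \<phi> {a, c} \<and> \<phi> {a, b} \<noteq> \<phi> {a, c}"

definition rainbow_free :: "'a set \<Rightarrow> ('a set \<Rightarrow> nat) \<Rightarrow> bool" where
  "rainbow_free V \<phi> \<longleftrightarrow> (\<forall>a\<in>V. \<forall>b\<in>V. \<forall>c\<in>V. \<not> rainbow \<phi> a b c)"

lemma pairs_iff: "e \<in> pairs V \<longleftrightarrow> (\<exists>u v. e = {u, v} \<and> u \<noteq> v \<and> u \<in> V \<and> v \<in> V)"
  unfolding pairs_def by (auto simp: card_2_iff)

lemma avoids_insert:
  "avoids \<phi> i (insert v A) \<longleftrightarrow> avoids \<phi> i A \<and> (\<forall>u\<in>A. u \<noteq> v \<longrightarrow> \<phi> {v, u} \<noteq> i)"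
  unfolding avoids_def by (auto simp: insert_commute)

lemma avoids_empty: "avoids \<phi> i {}"
  by (simp add: avoids_def)

lemma stable_chromatic_component_iff:
  "stable V (chromatic_component V \<phi> i) S \<longleftrightarrow> S \<subseteq> V \<and> avoids \<phi> i S"
proof
  assume st: "stable V (chromatic_component V \<phi> i) S"
  then have sub: "S \<subseteq> V" by (simp add: stable_def)
  have "\<phi> {u, v} \<noteq> i" if "u \<in> S" "v \<in> S" "u \<noteq> v" for u v
  proof
    assume "\<phi> {u, v} = i"
    with that sub have "{u, v} \<in> chromatic_component V \<phi> i"
      by (auto simp: chromatic_component_def pairs_iff)
    with st that show False by (auto simp: stable_def)
  qed
  with sub show "S \<subseteq> V \<and> avoids \<phi> i S" by (simp add: avoids_def)
next
  assume "S \<subseteq> V \<and> avoids \<phi> i S"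
  then show "stable V (chromatic_component V \<phi> i) S"
    by (auto simp: stable_def chromatic_component_def pairs_iff avoids_def)
qed

lemma stable_extends_to_maximal:
  assumes "finite W" and "stable W F S"
  obtains T where "S \<subseteq> T" and "maximal_stable W F T"
proof -
  have "finite {T. stable W F T}"
    by (rule finite_subset[of _ "Pow W"]) (auto simp: stable_def assms(1))
  then obtain T where "stable W F T" "S \<subseteq> T" and
    "\<forall>T'\<in>{T. stable W F T}. T \<subseteq> T' \<longrightarrow> T = T'"
    using finite_has_maximal2[of "{T. stable W F T}" S] assms(2) by auto
  then have "maximal_stable W F T" by (auto simp: maximal_stable_def)
  with \<open>S \<subseteq> T\<close> show ?thesis by (rule that)
qed

lemma pairs_mono: "W \<subseteq> V \<Longrightarrow> pairs W \<subseteq> pairs V"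
  by (auto simp: pairs_def)

lemma d_graph_mono: "d_graph d V \<phi> \<Longrightarrow> W \<subseteq> V \<Longrightarrow> d_graph d W \<phi>"
  unfolding d_graph_def by (blast intro: finite_subset dest: pairs_mono)

lemma d_graph_color:
  assumes "d_graph d V \<phi>" "u \<in> V" "v \<in> V" "u \<noteq> v"
  shows "\<phi> {u, v} \<in> {1..d}"
proof -
  have "{u, v} \<in> pairs V" using assms by (auto simp: pairs_def)
  then show ?thesis using assms(1) unfolding d_graph_def by blast
qed

text \<open>
  Maximal sets are awkward to transport between a graph and its subgraphs or quotients. Since every
  color-free set extends to a maximal one, and a maximal one absorbs each vertex by which it can be
  enlarged, maximality can be traded for the existence of a common one-vertex enlargement.
\<close>

lemma cis_d_graph_iff:
  assumes "1 \<le> d"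
  shows "cis_d_graph d V \<phi> \<longleftrightarrow> d_graph d V \<phi> \<and>
    (\<forall>A. (\<forall>i\<in>{1..d}. A i \<subseteq> V \<and> avoids \<phi> i (A i))
       \<longrightarrow> (\<exists>v\<in>V. \<forall>i\<in>{1..d}. avoids \<phi> i (insert v (A i))))"
    (is "?cis \<longleftrightarrow> ?dg \<and> ?ext")
proof
  assume cis: ?cis
  then have dg: ?dg by (simp add: cis_d_graph_def)
  have ext: ?ext
  proof (intro allI impI)
    fix A assume A: "\<forall>i\<in>{1..d}. A i \<subseteq> V \<and> avoids \<phi> i (A i)"
    have "\<exists>T. A i \<subseteq> T \<and> maximal_stable V (chromatic_component V \<phi> i) T"
      if "i \<in> {1..d}" for i
      using stable_extends_to_maximal[of V "chromatic_component V \<phi> i" "A i"] A dg that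
      by (metis d_graph_def stable_chromatic_component_iff)
    then obtain S where S: "\<And>i. i \<in> {1..d} \<Longrightarrow> A i \<subseteq> S i \<and>
        maximal_stable V (chromatic_component V \<phi> i) (S i)"
      by metis
    then have "(\<Inter>i\<in>{1..d}. S i) \<noteq> {}"
      using cis by (simp add: cis_d_graph_def)
    then obtain v where v: "\<And>i. i \<in> {1..d} \<Longrightarrow> v \<in> S i" by blast
    have st: "S i \<subseteq> V \<and> avoids \<phi> i (S i)" if "i \<in> {1..d}" for i
      using S[OF that] by (simp add: maximal_stable_def stable_chromatic_component_iff)
    have "avoids \<phi> i (insert v (A i))" if "i \<in> {1..d}" for i
      using st[OF that] S[OF that] v[OF that] unfolding avoids_def by blast
    moreover have "v \<in> V" using st[of 1] v[of 1] assms by auto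
    ultimately show "\<exists>v\<in>V. \<forall>i\<in>{1..d}. avoids \<phi> i (insert v (A i))" by blast
  qed
  from dg ext show "?dg \<and> ?ext" ..
next
  assume *: "?dg \<and> ?ext"
  have "(\<Inter>i\<in>{1..d}. S i) \<noteq> {}"
    if S: "\<forall>i\<in>{1..d}. maximal_stable V (chromatic_component V \<phi> i) (S i)" for S
  proof -
    from S have "\<forall>i\<in>{1..d}. S i \<subseteq> V \<and> avoids \<phi> i (S i)"
      by (simp add: maximal_stable_def stable_chromatic_component_iff)
    with * obtain v where v: "v \<in> V" "\<forall>i\<in>{1..d}. avoids \<phi> i (insert v (S i))" by blast
    have "v \<in> S i" if "i \<in> {1..d}" for i
    proof (rule ccontr)
      assume "v \<notin> S i"
      moreover have "stable V (chromatic_component V \<phi> i) (insert v (S i))"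
        using v that S by (auto simp: maximal_stable_def stable_chromatic_component_iff)
      ultimately show False using S that unfolding maximal_stable_def by blast
    qed
    then show ?thesis by blast
  qed
  with * show ?cis by (simp add: cis_d_graph_def)
qed

lemma cis_common_extension:
  assumes "1 \<le> d" and "cis_d_graph d V \<phi>"
    and "\<forall>i\<in>{1..d}. A i \<subseteq> V \<and> avoids \<phi> i (A i)"
  shows "\<exists>v\<in>V. \<forall>i\<in>{1..d}. avoids \<phi> i (insert v (A i))"
  using assms(2,3) unfolding cis_d_graph_iff[OF assms(1)] by blast

text \<open>
  Given color-free sets in the smaller graph, add \<open>a\<close> to the set for color \<open>i\<close>, which is possible
  because no \<open>i\<close>-neighbour of \<open>a\<close> is left. The common vertex that the large graph supplies is
  compatible with \<open>a\<close> in color \<open>i\<close>, hence it has not been deleted.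
\<close>

lemma cis_delete_color_neighbours:
  assumes d: "1 \<le> d" and cis: "cis_d_graph d V \<phi>" and a: "a \<in> V" and i: "i \<in> {1..d}"
  shows "cis_d_graph d {v\<in>V. v \<noteq> a \<longrightarrow> \<phi> {a, v} \<noteq> i} \<phi>" (is "cis_d_graph d ?R \<phi>")
  unfolding cis_d_graph_iff[OF d]
proof (intro conjI allI impI)
  show "d_graph d ?R \<phi>"
    using cis d_graph_mono[of d V \<phi> ?R] by (auto simp: cis_d_graph_def)
next
  fix A assume A: "\<forall>j\<in>{1..d}. A j \<subseteq> ?R \<and> avoids \<phi> j (A j)"
  let ?B = "A(i := insert a (A i))"
  have "\<forall>j\<in>{1..d}. ?B j \<subseteq> V \<and> avoids \<phi> j (?B j)"
    using A a i by (auto simp: avoids_insert)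
  then obtain v where v: "v \<in> V" "\<forall>j\<in>{1..d}. avoids \<phi> j (insert v (?B j))"
    using cis_common_extension[OF d cis, of ?B] by blast
  have "avoids \<phi> i (insert v (insert a (A i)))" using v(2) i by force
  then have "v \<in> ?R" using v(1) by (auto simp: avoids_def)
  moreover have "avoids \<phi> j (insert v (A j))" if "j \<in> {1..d}" for j
  proof -
    have "insert v (A j) \<subseteq> insert v (?B j)" by auto
    with v(2) that show ?thesis unfolding avoids_def by blast
  qed
  ultimately show "\<exists>v\<in>?R. \<forall>j\<in>{1..d}. avoids \<phi> j (insert v (A j))" by blast
qed

section \<open>CIS graphs have no rainbow triangle\<close>

lemma rainbow_rotate: "rainbow \<phi> a b c \<Longrightarrow> rainbow \<phi> b c a"
  by (auto simp: rainbow_def insert_commute)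

lemma rainbow_distinct: "rainbow \<phi> a b c \<Longrightarrow> a \<noteq> b \<and> b \<noteq> c \<and> a \<noteq> c"
  by (auto simp: rainbow_def insert_commute)

text \<open>
  Each edge of the triangle is free of the other two colors, so it can be assigned to one of these
  two. There are two cyclic assignments; this is one of them, the other one arises by exchanging
  \<open>b\<close> and \<open>c\<close>.
\<close>

lemma cis_common_vertex_of_rainbow:
  assumes d: "1 \<le> d" and cis: "cis_d_graph d V \<phi>"
    and V: "a \<in> V" "b \<in> V" "c \<in> V" and r: "rainbow \<phi> a b c"
  obtains p where "p \<in> V" "p \<noteq> a" "p \<noteq> b" "p \<noteq> c"
    "\<phi> {p, a} \<noteq> \<phi> {a, c}" "\<phi> {p, b} \<noteq> \<phi> {a, b}" "\<phi> {p, c} \<noteq> \<phi> {b, c}"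
proof -
  let ?A = "\<lambda>i. if i = \<phi> {b, c} then {a, c} else if i = \<phi> {a, c} then {a, b}
                else if i = \<phi> {a, b} then {b, c} else {}"
  note dist = rainbow_distinct[OF r]
  have dg: "d_graph d V \<phi>" using cis by (simp add: cis_d_graph_def)
  have cols: "\<phi> {b, c} \<in> {1..d}" "\<phi> {a, c} \<in> {1..d}" "\<phi> {a, b} \<in> {1..d}"
    using d_graph_color[OF dg] V dist by auto
  have "\<forall>i\<in>{1..d}. ?A i \<subseteq> V \<and> avoids \<phi> i (?A i)"
    using V r by (simp add: avoids_insert avoids_empty rainbow_def)
  from cis_common_extension[OF d cis this]
  obtain p where p: "p \<in> V" "\<forall>i\<in>{1..d}. avoids \<phi> i (insert p (?A i))" ..
  have 1: "avoids \<phi> (\<phi> {b, c}) {p, a, c}" "avoids \<phi> (\<phi> {a, c}) {p, a, b}"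
     "avoids \<phi> (\<phi> {a, b}) {p, b, c}"
    using bspec[OF p(2) cols(1)] bspec[OF p(2) cols(2)] bspec[OF p(2) cols(3)] r
    by (simp_all add: rainbow_def)
  have ne: "p \<noteq> a" "p \<noteq> b" "p \<noteq> c"
    using 1 dist unfolding avoids_def by blast+
  have "\<phi> {p, a} \<noteq> \<phi> {a, c}" "\<phi> {p, b} \<noteq> \<phi> {a, b}" "\<phi> {p, c} \<noteq> \<phi> {b, c}"
    using 1 ne unfolding avoids_def by blast+
  with that[OF p(1) ne] show ?thesis by blast
qed

text \<open>
  Minimality of a counterexample enters only through deletions, which determine the colors at the
  corners of a rainbow triangle; two more vertices then suffice for a contradiction.
\<close>

theorem cis_rainbow_free:
  assumes d: "1 \<le> d" and "cis_d_graph d V \<phi>"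
  shows "rainbow_free V \<phi>"
  using assms(2)
proof (induction "card V" arbitrary: V rule: less_induct)
  case less
  note cis = less.prems
  have dg: "d_graph d V \<phi>" and fin: "finite V"
    using cis by (auto simp: cis_d_graph_def d_graph_def)
  \<comment> \<open>A vertex of a rainbow triangle sees no color besides the two on its triangle edges: otherwise
      the triangle survives the deletion of its neighbours in that color.\<close>
  have two: "\<phi> {a, v} = \<phi> {a, b} \<or> \<phi> {a, v} = \<phi> {a, c}"
    if r: "rainbow \<phi> a b c" and V: "a \<in> V" "b \<in> V" "c \<in> V" "v \<in> V" and "v \<noteq> a" for a b c v
  proof (rule ccontr)
    assume no: "\<not> ?thesis"
    let ?R = "{w\<in>V. w \<noteq> a \<longrightarrow> \<phi> {a, w} \<noteq> \<phi> {a, v}}"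
    have "card ?R < card V"
      by (rule psubset_card_mono[OF fin]) (use V \<open>v \<noteq> a\<close> in auto)
    moreover have "cis_d_graph d ?R \<phi>"
      using cis_delete_color_neighbours[OF d cis] d_graph_color[OF dg] V \<open>v \<noteq> a\<close> by auto
    ultimately have "rainbow_free ?R \<phi>" by (rule less.hyps)
    moreover have "a \<in> ?R" "b \<in> ?R" "c \<in> ?R" using V no by auto
    ultimately show False using r by (auto simp: rainbow_free_def)
  qed
  have three: False
    if r: "rainbow \<phi> a b c" and V: "a \<in> V" "b \<in> V" "c \<in> V" for a b c
  proof -
    have sees: "\<phi> {p, a} = \<phi> {a, b} \<or> \<phi> {p, a} = \<phi> {a, c}"
      "\<phi> {p, b} = \<phi> {a, b} \<or> \<phi> {p, b} = \<phi> {b, c}"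
      "\<phi> {p, c} = \<phi> {a, c} \<or> \<phi> {p, c} = \<phi> {b, c}"
      if "p \<in> V" "p \<noteq> a" "p \<noteq> b" "p \<noteq> c" for p
      using two[OF r V that(1)] two[OF rainbow_rotate[OF r] V(2,3,1) that(1)]
        two[OF rainbow_rotate[OF rainbow_rotate[OF r]] V(3,1,2) that(1)] that
      by (auto simp: insert_commute)
    obtain p where p: "p \<in> V" "p \<noteq> a" "p \<noteq> b" "p \<noteq> c"
      "\<phi> {p, a} \<noteq> \<phi> {a, c}" "\<phi> {p, b} \<noteq> \<phi> {a, b}" "\<phi> {p, c} \<noteq> \<phi> {b, c}"
      by (rule cis_common_vertex_of_rainbow[OF d cis V r])
    have r': "rainbow \<phi> a c b" using r by (auto simp: rainbow_def insert_commute)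
    obtain q where q: "q \<in> V" "q \<noteq> a" "q \<noteq> b" "q \<noteq> c"
      "\<phi> {q, a} \<noteq> \<phi> {a, b}" "\<phi> {q, b} \<noteq> \<phi> {b, c}" "\<phi> {q, c} \<noteq> \<phi> {a, c}"
      by (rule cis_common_vertex_of_rainbow[OF d cis V(1,3,2) r'])
        (simp add: insert_commute)
    have pc: "\<phi> {p, a} = \<phi> {a, b}" "\<phi> {p, b} = \<phi> {b, c}" "\<phi> {p, c} = \<phi> {a, c}"
      using sees[OF p(1-4)] p by auto
    have qc: "\<phi> {q, a} = \<phi> {a, c}" "\<phi> {q, b} = \<phi> {a, b}" "\<phi> {q, c} = \<phi> {b, c}"
      using sees[OF q(1-4)] q by auto
    \<comment> \<open>At each of \<open>a\<close>, \<open>b\<close>, \<open>c\<close> the edges to \<open>p\<close> and \<open>q\<close> carry two different colors, and each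
        of the three triangle colors is absent from one of these pairs.\<close>
    have "rainbow \<phi> p a q \<or> rainbow \<phi> p b q \<or> rainbow \<phi> p c q"
      using r pc qc by (auto simp: rainbow_def insert_commute)
    then obtain x where x: "x \<in> V" "rainbow \<phi> p x q" using V by blast
    \<comment> \<open>But \<open>p\<close> is joined to \<open>a\<close>, \<open>b\<close>, \<open>c\<close> in three different colors.\<close>
    have "\<phi> {p, y} = \<phi> {p, x} \<or> \<phi> {p, y} = \<phi> {p, q}" if "y \<in> {a, b, c}" for y
      using two[OF x(2) p(1) x(1) q(1), of y] that V p by auto
    then show False using pc r unfolding rainbow_def by (metis insertI1 insertI2)
  qed
  then show ?case by (auto simp: rainbow_free_def)
qed

section \<open>Color components without rainbow triangles\<close>

definition color_graph :: "'a set \<Rightarrow> ('a set \<Rightarrow> nat) \<Rightarrow> nat \<Rightarrow> ('a \<times> 'a) set" where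
  "color_graph W \<phi> i = {(u, v). u \<in> W \<and> v \<in> W \<and> u \<noteq> v \<and> \<phi> {u, v} = i}"

definition color_component :: "'a set \<Rightarrow> ('a set \<Rightarrow> nat) \<Rightarrow> nat \<Rightarrow> 'a \<Rightarrow> 'a set" where
  "color_component W \<phi> i x = (color_graph W \<phi> i)\<^sup>* `` {x}"

definition color_connected :: "'a set \<Rightarrow> ('a set \<Rightarrow> nat) \<Rightarrow> nat \<Rightarrow> bool" where
  "color_connected W \<phi> i \<longleftrightarrow> (\<forall>x\<in>W. \<forall>y\<in>W. y \<in> color_component W \<phi> i x)"

lemma color_component_refl: "x \<in> color_component W \<phi> i x"
  by (simp add: color_component_def)

lemma color_component_sym:
  "y \<in> color_component W \<phi> i x \<longleftrightarrow> x \<in> color_component W \<phi> i y"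
proof -
  have "sym (color_graph W \<phi> i)"
    by (auto simp: sym_def color_graph_def insert_commute)
  then have "sym ((color_graph W \<phi> i)\<^sup>*)" by (rule sym_rtrancl)
  then show ?thesis unfolding color_component_def by (auto dest: symD)
qed

lemma color_component_trans:
  "y \<in> color_component W \<phi> i x \<Longrightarrow> z \<in> color_component W \<phi> i y \<Longrightarrow> z \<in> color_component W \<phi> i x"
  unfolding color_component_def by (auto intro: rtrancl_trans)

lemma color_component_subset:
  assumes "x \<in> W" shows "color_component W \<phi> i x \<subseteq> W"
proof
  fix y assume "y \<in> color_component W \<phi> i x"
  then have "(x, y) \<in> (color_graph W \<phi> i)\<^sup>*" by (simp add: color_component_def)
  then show "y \<in> W" by (induction) (use assms in \<open>auto simp: color_graph_def\<close>)
qed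

lemma color_component_edge:
  assumes "u \<in> color_component W \<phi> i x" "u \<in> W" "v \<in> W" "\<phi> {u, v} = i"
  shows "v \<in> color_component W \<phi> i x"
proof (cases "u = v")
  case False
  then have "(u, v) \<in> color_graph W \<phi> i" using assms by (simp add: color_graph_def)
  with assms(1) show ?thesis unfolding color_component_def by (auto intro: rtrancl_into_rtrancl)
qed (use assms in simp)

lemma color_component_leaves_set:
  assumes "y \<in> color_component W \<phi> i x" and "x \<in> S" and "y \<notin> S"
  obtains u v where "u \<in> color_component W \<phi> i x" "u \<in> S" "v \<notin> S"
    "u \<in> W" "v \<in> W" "u \<noteq> v" "\<phi> {u, v} = i"
proof -
  have "(x, y) \<in> (color_graph W \<phi> i)\<^sup>*" using assms(1) by (simp add: color_component_def)
  then have "y \<notin> S \<longrightarrow> (\<exists>u v. (x, u) \<in> (color_graph W \<phi> i)\<^sup>* \<and> u \<in> S \<and> v \<notin> S \<and>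
      (u, v) \<in> color_graph W \<phi> i)"
    by (induction) (use assms(2) in blast)+
  with assms(3) that show ?thesis by (auto simp: color_component_def color_graph_def)
qed

text \<open>
  A vertex \<open>y\<close> outside the component sends no \<open>i\<close>-edge into it, so on each \<open>i\<close>-edge of the
  component a rainbow triangle can only be avoided if \<open>y\<close> sees both ends in the same color. This
  propagates along the paths of the component.
\<close>

lemma color_component_is_module:
  assumes rf: "rainbow_free W \<phi>" and x: "x \<in> W"
  shows "is_module W \<phi> (color_component W \<phi> i x)" (is "is_module W \<phi> ?C")
proof -
  have same: "\<phi> {y, u} = \<phi> {y, x}" if y: "y \<in> W - ?C" and "u \<in> ?C" for y u
  proof -
    have "(x, u) \<in> (color_graph W \<phi> i)\<^sup>*" using that(2) by (simp add: color_component_def)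
    then show ?thesis
    proof (induction)
      case base
      show ?case ..
    next
      case (step u w)
      have uw: "u \<in> W" "w \<in> W" "\<phi> {u, w} = i" using step.hyps(2) by (auto simp: color_graph_def)
      have C: "u \<in> ?C" "w \<in> ?C"
        using step.hyps by (auto simp: color_component_def)
      have "\<phi> {u, y} \<noteq> i" "\<phi> {w, y} \<noteq> i"
        using color_component_edge[OF C(1) uw(1)] color_component_edge[OF C(2) uw(2)] y by auto
      moreover have "\<not> rainbow \<phi> y u w" using rf y uw by (auto simp: rainbow_free_def)
      ultimately have "\<phi> {y, u} = \<phi> {y, w}" using uw(3) by (auto simp: rainbow_def insert_commute)
      with step.IH show ?case by simp
    qed
  qed
  then have "\<phi> {y, u} = \<phi> {y, v}" if "y \<in> W - ?C" "u \<in> ?C" "v \<in> ?C" for y u v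
    using that by metis
  then show ?thesis
    unfolding is_module_def
    using color_component_subset[OF x] color_component_refl[of x W \<phi> i] by blast
qed

lemma module_color:
  assumes "is_module V \<phi> M" "x \<in> V" "x \<notin> M" "u \<in> M" "v \<in> M"
  shows "\<phi> {x, u} = \<phi> {x, v}"
  using assms unfolding is_module_def by blast

lemma rainbow_free_mono: "rainbow_free V \<phi> \<Longrightarrow> W \<subseteq> V \<Longrightarrow> rainbow_free W \<phi>"
  unfolding rainbow_free_def by blast

lemma color_connected_neighbour:
  assumes "color_connected W \<phi> i" "x \<in> W" "y \<in> W" "y \<noteq> x"
  obtains w where "w \<in> W - {x}" "\<phi> {x, w} = i"
proof -
  have "y \<in> color_component W \<phi> i x" using assms by (simp add: color_connected_def)
  from color_component_leaves_set[OF this, of "{x}"] assms(4) that show ?thesis by auto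
qed

text \<open>
  As color \<open>k\<close> connects everything to \<open>x\<close>, every \<open>k\<close>-component of the rest contains a
  \<open>k\<close>-neighbour \<open>u\<close> of \<open>x\<close>. If \<open>w\<close> is joined to \<open>x\<close> in another color, then for such a \<open>u\<close> in a
  different component the triangle \<open>x\<close>, \<open>w\<close>, \<open>u\<close> forces \<open>wu\<close> to have the color of \<open>xw\<close>. As
  components are modules, this color spreads to all edges between the component of \<open>w\<close> and its
  complement.
\<close>

lemma color_after_deletion_between_components:
  assumes rf: "rainbow_free W \<phi>" and x: "x \<in> W"
    and k: "color_connected W \<phi> k"
    and w: "w \<in> W - {x}" "\<phi> {x, w} \<noteq> k"
    and v: "v \<in> color_component (W - {x}) \<phi> k w"
    and z: "z \<in> W - {x}" "z \<notin> color_component (W - {x}) \<phi> k w"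
  shows "\<phi> {v, z} = \<phi> {x, w}"
proof -
  let ?W = "W - {x}" and ?C = "color_component (W - {x}) \<phi> k"
  have rf': "rainbow_free ?W \<phi>" using rainbow_free_mono[OF rf] by blast
  have "x \<in> color_component W \<phi> k z" using k x z by (simp add: color_connected_def)
  moreover have "x \<notin> ?C z" using color_component_subset[OF z(1)] by blast
  ultimately obtain u t where ut: "u \<in> ?C z" "t \<notin> ?C z" "t \<in> W" "\<phi> {u, t} = k"
    using color_component_leaves_set[of x W \<phi> k z "?C z"] color_component_refl by metis
  have uW: "u \<in> ?W" using ut(1) color_component_subset[OF z(1)] by blast
  have "t = x" using color_component_edge[OF ut(1) uW] ut by blast
  then have ux: "\<phi> {x, u} = k" using ut(4) by (simp add: insert_commute)
  have wz: "w \<notin> ?C z" using z(2) color_component_sym by metis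
  have "\<phi> {u, w} \<noteq> k" using color_component_edge[OF ut(1) uW w(1)] wz by blast
  moreover have "\<not> rainbow \<phi> x w u" using rf x w(1) uW by (auto simp: rainbow_free_def)
  ultimately have "\<phi> {w, u} = \<phi> {x, w}"
    using ux w(2) by (auto simp: rainbow_def insert_commute)
  moreover have "\<phi> {w, u} = \<phi> {w, z}"
    using module_color[OF color_component_is_module[OF rf' z(1)] w(1) wz ut(1)]
      color_component_refl by metis
  moreover have "\<phi> {z, v} = \<phi> {z, w}"
    using module_color[OF color_component_is_module[OF rf' w(1)] z v]
      color_component_refl by metis
  ultimately show ?thesis by (simp add: insert_commute)
qed

text \<open>
  Both \<open>l\<close> and \<open>m\<close> occur at \<open>x\<close>. If deleting \<open>x\<close> disconnected color \<open>k\<close>, then the component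
  containing an \<open>l\<close>-neighbour of \<open>x\<close> would send only color \<open>l\<close> to the outside, and the one
  containing an \<open>m\<close>-neighbour only color \<open>m\<close>; but some edge leaves both components.
\<close>

lemma three_connected_colors_step:
  assumes rf: "rainbow_free W \<phi>" and x: "x \<in> W" and y: "y \<in> W" "y \<noteq> x"
    and con: "color_connected W \<phi> k" "color_connected W \<phi> l" "color_connected W \<phi> m"
    and ne: "k \<noteq> l" "k \<noteq> m" "l \<noteq> m"
  shows "color_connected (W - {x}) \<phi> k"
proof (rule ccontr)
  assume not_k: "\<not> ?thesis"
  let ?W = "W - {x}" and ?C = "color_component (W - {x}) \<phi> k"
  obtain w where w: "w \<in> ?W" "\<phi> {x, w} = l" by (rule color_connected_neighbour[OF con(2) x y])
  obtain w' where w': "w' \<in> ?W" "\<phi> {x, w'} = m" by (rule color_connected_neighbour[OF con(3) x y])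
  note outside = color_after_deletion_between_components[OF rf x con(1)]
  show False
  proof (cases "w' \<in> ?C w")
    case True
    obtain a b where ab: "a \<in> ?W" "b \<in> ?W" "b \<notin> ?C a"
      using not_k by (auto simp: color_connected_def)
    then obtain z where z: "z \<in> ?W" "z \<notin> ?C w"
      using color_component_sym color_component_trans by metis
    then have "z \<notin> ?C w'" using True color_component_trans by metis
    then have "\<phi> {w', z} = l" "\<phi> {w', z} = m"
      using outside[OF w(1) _ True z] outside[OF w'(1) _ color_component_refl z(1)] w w' ne by auto
    with ne show False by simp
  next
    case False
    then have "w \<notin> ?C w'" using color_component_sym by metis
    then have "\<phi> {w, w'} = l" "\<phi> {w', w} = m"
      using outside[OF w(1) _ color_component_refl w'(1) False]
        outside[OF w'(1) _ color_component_refl w(1)] w w' ne by auto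
    with ne show False by (simp add: insert_commute)
  qed
qed

text \<open>
  This is Gallai's theorem in the form that of any three colors one is disconnected. Deleting
  vertices one at a time keeps three connected colors connected, down to two vertices, where only
  one color is left.
\<close>

theorem rainbow_free_two_connected_colors:
  assumes "finite W" and "2 \<le> card W" and "rainbow_free W \<phi>"
    and "i \<noteq> j" "i \<noteq> k" "j \<noteq> k"
  shows "\<not> (color_connected W \<phi> i \<and> color_connected W \<phi> j \<and> color_connected W \<phi> k)"
  using assms(1-3)
proof (induction "card W" arbitrary: W rule: less_induct)
  case less
  show ?case
  proof
    assume con: "color_connected W \<phi> i \<and> color_connected W \<phi> j \<and> color_connected W \<phi> k"
    have "\<not> is_singleton W" using less.prems(2) by (auto simp: is_singleton_altdef)
    then obtain x y where xy: "x \<in> W" "y \<in> W" "y \<noteq> x"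
      using less.prems(2) by (metis card.empty is_singletonI' not_numeral_le_zero)
    let ?W = "W - {x}"
    have rf': "rainbow_free ?W \<phi>" using rainbow_free_mono less.prems(3) by blast
    have "color_connected ?W \<phi> i" "color_connected ?W \<phi> j" "color_connected ?W \<phi> k"
      using three_connected_colors_step[OF less.prems(3) xy] con assms(4-6) by metis+
    then have "\<not> 2 \<le> card ?W"
      using less.hyps[of ?W] less.prems(1) rf' xy by (metis card_Diff1_less finite_Diff)
    then have one: "u = v" if "u \<in> ?W" "v \<in> ?W" for u v
      using that less.prems(1) card_le_Suc0_iff_eq[of ?W] by auto
    obtain u where "u \<in> ?W" "\<phi> {x, u} = i"
      using color_connected_neighbour[of W \<phi> i x y] con xy by metis
    moreover obtain v where "v \<in> ?W" "\<phi> {x, v} = j"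
      using color_connected_neighbour[of W \<phi> j x y] con xy by metis
    ultimately show False using one assms(4) by metis
  qed
qed

section \<open>Quotients by partitions into modules\<close>

lemma disjoint_modules_color:
  assumes A: "is_module V \<phi> A" and B: "is_module V \<phi> B" and disj: "A \<inter> B = {}"
    and mem: "a \<in> A" "a' \<in> A" "b \<in> B" "b' \<in> B"
  shows "\<phi> {a, b} = \<phi> {a', b'}"
proof -
  have sub: "A \<subseteq> V" "B \<subseteq> V" using A B by (auto simp: is_module_def)
  have "\<phi> {b, a} = \<phi> {b, a'}"
    by (rule module_color[OF A]) (use sub mem disj in auto)
  moreover have "\<phi> {a', b} = \<phi> {a', b'}"
    by (rule module_color[OF B]) (use sub mem disj in auto)
  ultimately show ?thesis by (simp add: insert_commute)
qed

definition module_partition :: "'a set \<Rightarrow> ('a set \<Rightarrow> nat) \<Rightarrow> 'a set \<Rightarrow> 'a set set \<Rightarrow> bool" where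
  "module_partition V \<phi> M P \<longleftrightarrow>
     is_module V \<phi> M \<and> partition_on M P \<and> (\<forall>A\<in>P. is_module V \<phi> A)"

lemma module_partition_disjoint:
  "module_partition V \<phi> M P \<Longrightarrow> A \<in> P \<Longrightarrow> B \<in> P \<Longrightarrow> A \<noteq> B \<Longrightarrow> A \<inter> B = {}"
  by (auto simp: module_partition_def partition_on_def dest: disjointD)

lemma module_partition_nonempty: "module_partition V \<phi> M P \<Longrightarrow> A \<in> P \<Longrightarrow> A \<noteq> {}"
  by (auto simp: module_partition_def is_module_def)

lemma module_partition_Union: "module_partition V \<phi> M P \<Longrightarrow> \<Union>P = M"
  by (simp add: module_partition_def partition_on_def)

lemma module_partition_subset: "module_partition V \<phi> M P \<Longrightarrow> M \<subseteq> V"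
  by (simp add: module_partition_def is_module_def)

lemma quotient_coloring_eq:
  assumes P: "module_partition V \<phi> M P" and AB: "A \<in> P" "B \<in> P" "A \<noteq> B"
    and ab: "a \<in> A" "b \<in> B"
  shows "quotient_coloring \<phi> {A, B} = \<phi> {a, b}"
proof -
  have mods: "is_module V \<phi> A" "is_module V \<phi> B"
    using P AB by (auto simp: module_partition_def)
  have same: "\<phi> {a', b'} = \<phi> {a, b}" "\<phi> {b', a'} = \<phi> {a, b}" if "a' \<in> A" "b' \<in> B" for a' b'
    using disjoint_modules_color[OF mods module_partition_disjoint[OF P AB] that(1) ab(1) that(2) ab(2)]
    by (simp_all add: insert_commute)
  show ?thesis unfolding quotient_coloring_def
  proof (rule the_equality)
    show "\<forall>X\<in>{A, B}. \<forall>Y\<in>{A, B}. X \<noteq> Y \<longrightarrow> (\<forall>x\<in>X. \<forall>y\<in>Y. \<phi> {x, y} = \<phi> {a, b})"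
      using same by blast
  next
    fix c assume "\<forall>X\<in>{A, B}. \<forall>Y\<in>{A, B}. X \<noteq> Y \<longrightarrow> (\<forall>x\<in>X. \<forall>y\<in>Y. \<phi> {x, y} = c)"
    then have "\<forall>x\<in>A. \<forall>y\<in>B. \<phi> {x, y} = c" using AB(3) by simp
    with ab show "c = \<phi> {a, b}" by simp
  qed
qed

lemma module_partition_finite: "module_partition V \<phi> M P \<Longrightarrow> finite V \<Longrightarrow> finite P"
  unfolding module_partition_def is_module_def by (meson finite_elements finite_subset)

lemma d_graph_quotient:
  assumes dg: "d_graph d V \<phi>" and P: "module_partition V \<phi> M P"
  shows "d_graph d P (quotient_coloring \<phi>)"
proof -
  have "quotient_coloring \<phi> e \<in> {1..d}" if e: "e \<in> pairs P" for e
  proof -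
    from e obtain A B where AB: "e = {A, B}" "A \<noteq> B" "A \<in> P" "B \<in> P"
      unfolding pairs_iff by blast
    obtain a b where ab: "a \<in> A" "b \<in> B" using module_partition_nonempty[OF P] AB by blast
    have "a \<in> V" "b \<in> V"
      using ab AB module_partition_Union[OF P] module_partition_subset[OF P] by blast+
    moreover have "a \<noteq> b" using module_partition_disjoint[OF P AB(3,4,2)] ab by blast
    ultimately show ?thesis
      using d_graph_color[OF dg] quotient_coloring_eq[OF P AB(3,4,2) ab] AB(1) by simp
  qed
  then show ?thesis
    using dg module_partition_finite[OF P] unfolding d_graph_def by blast
qed

lemma avoids_image_insertD:
  "avoids \<phi> i (insert v (f ` S)) \<Longrightarrow> A \<in> S \<Longrightarrow> f A \<noteq> v \<Longrightarrow> \<phi> {v, f A} \<noteq> i"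
  by (simp add: avoids_insert)

text \<open>
  Given color-free sets of blocks, pick representatives and take a common enlarging vertex \<open>v\<close> in
  the large graph; the block of \<open>v\<close> enlarges the sets of blocks. For this \<open>v\<close> must lie in \<open>M\<close>.
  A vertex outside the module sees all of \<open>M\<close> in one color \<open>c\<close>, so it cannot enlarge a nonempty
  subset of \<open>M\<close> that is to stay free of color \<open>c\<close>.
\<close>

theorem cis_quotient:
  assumes d: "1 \<le> d" and cis: "cis_d_graph d V \<phi>" and P: "module_partition V \<phi> M P"
  shows "cis_d_graph d P (quotient_coloring \<phi>)"
  unfolding cis_d_graph_iff[OF d]
proof (intro conjI allI impI)
  have dg: "d_graph d V \<phi>" using cis by (simp add: cis_d_graph_def)
  show "d_graph d P (quotient_coloring \<phi>)" by (rule d_graph_quotient[OF dg P])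
  have mod: "is_module V \<phi> M" using P by (simp add: module_partition_def)
  then have MV: "M \<subseteq> V" and "M \<noteq> {}" by (auto simp: is_module_def)
  then obtain A0 where A0: "A0 \<in> P" using module_partition_Union[OF P] by blast
  fix T assume T: "\<forall>i\<in>{1..d}. T i \<subseteq> P \<and> avoids (quotient_coloring \<phi>) i (T i)"
  \<comment> \<open>Nonempty sets are needed to force the common vertex into \<open>M\<close>; single blocks are free of every
      color.\<close>
  define T' where "T' i = (if T i = {} then {A0} else T i)" for i
  have T': "T' i \<subseteq> P" "avoids (quotient_coloring \<phi>) i (T' i)" "T' i \<noteq> {}" "T i \<subseteq> T' i"
    if "i \<in> {1..d}" for i
    using T that A0 by (auto simp: T'_def avoids_def)
  have "\<exists>f. \<forall>A\<in>P. f A \<in> A"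
    using module_partition_nonempty[OF P] by (intro bchoice) blast
  then obtain f where f: "\<And>A. A \<in> P \<Longrightarrow> f A \<in> A" by blast
  then have fM: "f A \<in> M" if "A \<in> P" for A using that module_partition_Union[OF P] by blast
  have "\<forall>i\<in>{1..d}. f ` T' i \<subseteq> V \<and> avoids \<phi> i (f ` T' i)"
  proof (intro ballI conjI)
    fix i assume i: "i \<in> {1..d}"
    show "f ` T' i \<subseteq> V" using T'(1)[OF i] fM MV by blast
    show "avoids \<phi> i (f ` T' i)" unfolding avoids_def
    proof (intro ballI impI)
      fix u v assume "u \<in> f ` T' i" "v \<in> f ` T' i" "u \<noteq> v"
      then obtain A B where AB: "A \<in> T' i" "B \<in> T' i" "u = f A" "v = f B" "A \<noteq> B" by blast
      then have "A \<in> P" "B \<in> P" using T'(1)[OF i] by blast+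
      then have "\<phi> {u, v} = quotient_coloring \<phi> {A, B}"
        using quotient_coloring_eq[OF P _ _ AB(5) f f] AB(3,4) by simp
      then show "\<phi> {u, v} \<noteq> i" using T'(2)[OF i] AB by (simp add: avoids_def)
    qed
  qed
  from cis_common_extension[OF d cis this]
  obtain v where v: "v \<in> V" "\<forall>i\<in>{1..d}. avoids \<phi> i (insert v (f ` T' i))" ..
  have "v \<in> M"
  proof (rule ccontr)
    assume "v \<notin> M"
    let ?c = "\<phi> {v, f A0}"
    have c: "?c \<in> {1..d}"
      using d_graph_color[OF dg v(1), of "f A0"] fM[OF A0] MV \<open>v \<notin> M\<close> by blast
    then obtain A where A: "A \<in> T' ?c" "A \<in> P" using T'(1,3) by blast
    have "\<phi> {v, f A} = ?c"
      by (rule module_color[OF mod v(1) \<open>v \<notin> M\<close> fM[OF A(2)] fM[OF A0]])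
    moreover have "\<phi> {v, f A} \<noteq> ?c"
      using avoids_image_insertD[OF bspec[OF v(2) c] A(1)] fM[OF A(2)] \<open>v \<notin> M\<close> by metis
    ultimately show False by simp
  qed
  then obtain A where A: "A \<in> P" "v \<in> A" using module_partition_Union[OF P] by blast
  have "avoids (quotient_coloring \<phi>) i (insert A (T i))" if i: "i \<in> {1..d}" for i
    unfolding avoids_insert
  proof (intro conjI ballI impI)
    show "avoids (quotient_coloring \<phi>) i (T i)" using T i by blast
    fix B assume B: "B \<in> T i" "B \<noteq> A"
    then have BP: "B \<in> P" "B \<in> T' i" using T'(1,4)[OF i] by auto
    have "f B \<noteq> v" using module_partition_disjoint[OF P BP(1) A(1) B(2)] f[OF BP(1)] A(2) by blast
    then have "\<phi> {v, f B} \<noteq> i" by (rule avoids_image_insertD[OF bspec[OF v(2) i] BP(2)])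
    then show "quotient_coloring \<phi> {A, B} \<noteq> i"
      using quotient_coloring_eq[OF P A(1) BP(1) _ A(2) f[OF BP(1)]] B(2) by simp
  qed
  with A(1) show "\<exists>A\<in>P. \<forall>i\<in>{1..d}. avoids (quotient_coloring \<phi>) i (insert A (T i))" by blast
qed

section \<open>Strong modules and the colors of their quotients\<close>

lemma strong_module_laminar:
  assumes "strong_module V \<phi> X" "strong_module V \<phi> Y"
  shows "X \<subseteq> Y \<or> Y \<subseteq> X \<or> X \<inter> Y = {}"
  using assms unfolding strong_module_def overlap_def by blast

lemma strong_module_singleton: "v \<in> V \<Longrightarrow> strong_module V \<phi> {v}"
  unfolding strong_module_def is_module_def overlap_def by auto

lemma strong_module_whole: "V \<noteq> {} \<Longrightarrow> strong_module V \<phi> V"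
  unfolding strong_module_def is_module_def overlap_def by auto

lemma children_disjoint:
  assumes "A \<in> children V \<phi> M" "B \<in> children V \<phi> M" "A \<noteq> B"
  shows "A \<inter> B = {}"
  using assms strong_module_laminar[of V \<phi> A B] unfolding children_def by blast

lemma strong_module_below_child:
  assumes fin: "finite V" and S: "strong_module V \<phi> S" and M: "M \<subseteq> V" and "S \<subset> M"
  obtains C where "C \<in> children V \<phi> M" "S \<subseteq> C"
proof -
  let ?F = "{D. strong_module V \<phi> D \<and> D \<subset> M}"
  have "finite ?F" by (rule finite_subset[of _ "Pow V"]) (use fin M in auto)
  then obtain C where "C \<in> ?F" "S \<subseteq> C" "\<forall>D\<in>?F. C \<subseteq> D \<longrightarrow> C = D"
    using finite_has_maximal2[of ?F S] assms by auto
  then have "C \<in> children V \<phi> M" unfolding children_def by blast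
  from this \<open>S \<subseteq> C\<close> show ?thesis by (rule that)
qed

lemma children_module_partition:
  assumes fin: "finite V" and M: "strong_module V \<phi> M" and ns: "\<not> is_singleton M"
  shows "module_partition V \<phi> M (children V \<phi> M)"
  unfolding module_partition_def
proof (intro conjI ballI)
  show mod: "is_module V \<phi> M" using M by (simp add: strong_module_def)
  then have MV: "M \<subseteq> V" by (simp add: is_module_def)
  show "is_module V \<phi> A" if "A \<in> children V \<phi> M" for A
    using that by (simp add: children_def strong_module_def)
  show "partition_on M (children V \<phi> M)"
  proof (rule partition_onI)
    show "\<Union>(children V \<phi> M) = M"
    proof
      show "\<Union>(children V \<phi> M) \<subseteq> M" by (auto simp: children_def)
      show "M \<subseteq> \<Union>(children V \<phi> M)"
      proof
        fix v assume v: "v \<in> M"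
        then have "{v} \<subset> M" using ns by (auto simp: is_singleton_def)
        then obtain C where "C \<in> children V \<phi> M" "{v} \<subseteq> C"
          using strong_module_below_child[OF fin strong_module_singleton MV] v MV by blast
        then show "v \<in> \<Union>(children V \<phi> M)" by blast
      qed
    qed
  next
    fix A B assume "A \<in> children V \<phi> M" "B \<in> children V \<phi> M" "A \<noteq> B"
    then show "disjnt A B" using children_disjoint by (simp add: disjnt_def)
  next
    show "{} \<notin> children V \<phi> M"
      by (auto simp: children_def strong_module_def is_module_def)
  qed
qed

lemma Union_module_is_module:
  assumes P: "module_partition V \<phi> M P" and C: "is_module P (quotient_coloring \<phi>) C"
  shows "is_module V \<phi> (\<Union>C)"
proof -
  have CP: "C \<subseteq> P" and "C \<noteq> {}" using C by (auto simp: is_module_def)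
  have mod: "is_module V \<phi> M" using P by (simp add: module_partition_def)
  have "\<Union>C \<noteq> {}" using \<open>C \<noteq> {}\<close> CP module_partition_nonempty[OF P] by blast
  moreover have "\<Union>C \<subseteq> M" using CP module_partition_Union[OF P] by blast
  moreover have "\<phi> {x, u} = \<phi> {x, v}"
    if x: "x \<in> V - \<Union>C" and uv: "u \<in> \<Union>C" "v \<in> \<Union>C" for x u v
  proof (cases "x \<in> M")
    case False
    then show ?thesis using module_color[OF mod] x uv \<open>\<Union>C \<subseteq> M\<close> by blast
  next
    case True
    then obtain X where X: "X \<in> P" "x \<in> X" using module_partition_Union[OF P] by blast
    then have "X \<notin> C" using x by blast
    obtain K L where K: "K \<in> C" "u \<in> K" and L: "L \<in> C" "v \<in> L" using uv by blast
    have "quotient_coloring \<phi> {X, K} = quotient_coloring \<phi> {X, L}"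
      by (rule module_color[OF C X(1) \<open>X \<notin> C\<close> K(1) L(1)])
    moreover have "quotient_coloring \<phi> {X, K} = \<phi> {x, u}"
      by (rule quotient_coloring_eq[OF P X(1) _ _ X(2) K(2)]) (use K CP \<open>X \<notin> C\<close> in auto)
    moreover have "quotient_coloring \<phi> {X, L} = \<phi> {x, v}"
      by (rule quotient_coloring_eq[OF P X(1) _ _ X(2) L(2)]) (use L CP \<open>X \<notin> C\<close> in auto)
    ultimately show ?thesis by simp
  qed
  ultimately show ?thesis using mod unfolding is_module_def by blast
qed

text \<open>
  Suppose a module \<open>N\<close> overlaps the union of the component. As \<open>M\<close> and its children are strong, \<open>N\<close>
  lies in \<open>M\<close> and is a union of children, some inside the component and some outside. The component
  is connected, so an \<open>i\<close>-edge leads from a child inside \<open>N\<close> to a child \<open>L\<close> of the component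
  outside \<open>N\<close>. Since \<open>N\<close> is a module, \<open>L\<close> sees all of \<open>N\<close> in color \<open>i\<close>, also the part outside
  the component, which is impossible.
\<close>

lemma color_component_of_children_strong:
  fixes V :: "'a set"
  assumes fin: "finite V" and M: "strong_module V \<phi> M" and ns: "\<not> is_singleton M"
    and rf: "rainbow_free (children V \<phi> M) (quotient_coloring \<phi>)"
    and A: "A \<in> children V \<phi> M"
  shows "strong_module V \<phi> (\<Union>(color_component (children V \<phi> M) (quotient_coloring \<phi>) i A))"
    (is "strong_module V \<phi> (\<Union>?C)")
proof -
  let ?Q = "children V \<phi> M" and ?\<psi> = "quotient_coloring \<phi>"
  note P = children_module_partition[OF fin M ns]
  have CQ: "?C \<subseteq> ?Q" by (rule color_component_subset[OF A])
  have CM: "\<Union>?C \<subseteq> M" using CQ module_partition_Union[OF P] by blast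
  have modC: "is_module V \<phi> (\<Union>?C)"
    by (rule Union_module_is_module[OF P color_component_is_module[OF rf A]])
  have "\<not> overlap (\<Union>?C) N" if N: "is_module V \<phi> N" for N
  proof
    assume ov: "overlap (\<Union>?C) N"
    then have "N \<inter> M \<noteq> {}" "\<not> M \<subseteq> N" using CM by (auto simp: overlap_def)
    then have NM: "N \<subseteq> M" using M N unfolding strong_module_def overlap_def by blast
    obtain K0 n where n: "n \<in> N" "n \<in> K0" "K0 \<in> ?C" using ov by (auto simp: overlap_def)
    have notin: "\<not> N \<subseteq> K" if K: "K \<in> ?Q" for K
    proof
      assume "N \<subseteq> K"
      then have "K = K0" using n children_disjoint[of K V \<phi> M K0] K CQ by blast
      then show False using \<open>N \<subseteq> K\<close> n(3) ov by (auto simp: overlap_def)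
    qed
    have meets: "K \<subseteq> N \<or> K \<inter> N = {}" if K: "K \<in> ?Q" for K
    proof -
      have "strong_module V \<phi> K" using K by (simp add: children_def)
      then show ?thesis using N notin[OF K] unfolding strong_module_def overlap_def by blast
    qed
    obtain L0 where L0: "L0 \<in> ?C" "\<not> L0 \<subseteq> N" using ov by (auto simp: overlap_def)
    have "K0 \<subseteq> N" using meets[of K0] n CQ by blast
    have "L0 \<in> color_component ?Q ?\<psi> i K0"
      using L0(1) n(3) color_component_sym color_component_trans by metis
    then obtain K L where KL: "K \<in> color_component ?Q ?\<psi> i K0" "K \<subseteq> N" "\<not> L \<subseteq> N"
      "K \<in> ?Q" "L \<in> ?Q" "K \<noteq> L" "?\<psi> {K, L} = i"
      using color_component_leaves_set[of L0 ?Q ?\<psi> i K0 "{K. K \<subseteq> N}"] \<open>K0 \<subseteq> N\<close> L0(2)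
      by auto
    have "K \<in> ?C" using color_component_trans[OF n(3) KL(1)] .
    then have LC: "L \<in> ?C" using KL(4,5,7) by (rule color_component_edge)
    have "L \<inter> N = {}" using meets[OF KL(5)] KL(3) by simp
    obtain n' where n': "n' \<in> N" "n' \<notin> \<Union>?C" using ov by (auto simp: overlap_def)
    then obtain D where D: "D \<in> ?Q" "n' \<in> D" "D \<notin> ?C"
      using NM module_partition_Union[OF P] by blast
    obtain k l where kl: "k \<in> K" "l \<in> L" using module_partition_nonempty[OF P] KL(4,5) by blast
    have "l \<in> V" "l \<notin> N" "k \<in> N"
      using kl KL \<open>L \<inter> N = {}\<close> module_partition_Union[OF P] module_partition_subset[OF P] by blast+
    then have "\<phi> {l, k} = \<phi> {l, n'}" using module_color[OF N _ _ _ n'(1)] by blast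
    moreover have "?\<psi> {L, K} = \<phi> {l, k}"
      using quotient_coloring_eq[OF P KL(5,4) _ kl(2,1)] KL(6) by blast
    moreover have "?\<psi> {L, D} = \<phi> {l, n'}"
      using quotient_coloring_eq[OF P KL(5) D(1) _ kl(2) D(2)] LC D(3) by blast
    ultimately have "?\<psi> {L, D} = i" using KL(7) by (simp add: insert_commute)
    then have "D \<in> ?C" by (rule color_component_edge[OF LC KL(5) D(1)])
    with D(3) show False ..
  qed
  with modC show ?thesis by (simp add: strong_module_def)
qed

text \<open>
  Otherwise the component of an edge of this color would give a strong module strictly between a
  child of \<open>M\<close> and \<open>M\<close>.
\<close>

lemma used_color_connected_on_children:
  assumes fin: "finite V" and M: "strong_module V \<phi> M" and ns: "\<not> is_singleton M"
    and rf: "rainbow_free (children V \<phi> M) (quotient_coloring \<phi>)"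
    and i: "i \<in> colors_used (children V \<phi> M) (quotient_coloring \<phi>)"
  shows "color_connected (children V \<phi> M) (quotient_coloring \<phi>) i"
proof (rule ccontr)
  let ?Q = "children V \<phi> M" and ?\<psi> = "quotient_coloring \<phi>"
  assume not_con: "\<not> color_connected ?Q ?\<psi> i"
  note P = children_module_partition[OF fin M ns]
  from i obtain e where e: "e \<in> pairs ?Q" "?\<psi> e = i" unfolding colors_used_def by blast
  then obtain A B where AB: "A \<in> ?Q" "B \<in> ?Q" "A \<noteq> B" "?\<psi> {A, B} = i"
    unfolding pairs_iff by blast
  let ?C = "color_component ?Q ?\<psi> i A"
  have "A \<in> ?C" by (rule color_component_refl)
  then have "B \<in> ?C" using color_component_edge AB by metis
  obtain D where D: "D \<in> ?Q" "D \<notin> ?C"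
    using not_con color_component_sym color_component_trans unfolding color_connected_def by metis
  have CQ: "?C \<subseteq> ?Q" by (rule color_component_subset[OF AB(1)])
  have "D \<inter> \<Union>?C = {}" using D CQ children_disjoint by blast
  moreover have "D \<noteq> {}" "D \<subseteq> M" "\<Union>?C \<subseteq> M"
    using module_partition_nonempty[OF P D(1)] module_partition_Union[OF P] D(1) CQ by blast+
  ultimately have "\<Union>?C \<subset> M" by blast
  moreover have "strong_module V \<phi> (\<Union>?C)"
    by (rule color_component_of_children_strong[OF fin M ns rf AB(1)])
  moreover have "A \<subset> \<Union>?C"
    using \<open>A \<in> ?C\<close> \<open>B \<in> ?C\<close> children_disjoint[OF AB(1-3)] module_partition_nonempty[OF P AB(2)]
    by blast
  ultimately show False using AB(1) unfolding children_def by blast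
qed

theorem quotient_at_most_two_colors:
  assumes fin: "finite V" and M: "strong_module V \<phi> M" and ns: "\<not> is_singleton M"
    and rf: "rainbow_free (children V \<phi> M) (quotient_coloring \<phi>)"
  shows "card (colors_used (children V \<phi> M) (quotient_coloring \<phi>)) \<le> 2"
proof (rule ccontr)
  let ?Q = "children V \<phi> M" and ?\<psi> = "quotient_coloring \<phi>"
  assume "\<not> ?thesis"
  then have "3 \<le> card (colors_used ?Q ?\<psi>)" by simp
  then obtain S where "S \<subseteq> colors_used ?Q ?\<psi>" "card S = 3" using obtain_subset_with_card_n by metis
  then obtain i j k where ijk: "{i, j, k} \<subseteq> colors_used ?Q ?\<psi>" "i \<noteq> j" "i \<noteq> k" "j \<noteq> k"
    by (metis card_3_iff)
  then have con: "color_connected ?Q ?\<psi> i" "color_connected ?Q ?\<psi> j" "color_connected ?Q ?\<psi> k"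
    using used_color_connected_on_children[OF fin M ns rf] by auto
  have finQ: "finite ?Q" by (rule module_partition_finite[OF children_module_partition[OF fin M ns] fin])
  obtain e where "e \<in> pairs ?Q" using ijk(1) by (auto simp: colors_used_def)
  then have "2 \<le> card ?Q" using card_mono[OF finQ, of e] by (simp add: pairs_def)
  with rainbow_free_two_connected_colors[OF finQ _ rf ijk(2-4)] con show False by blast
qed

section \<open>The tree of a laminar family\<close>

definition lower_covers :: "'a set set \<Rightarrow> 'a set \<Rightarrow> 'a set set" where
  "lower_covers F X = {Y\<in>F. Y \<subset> X \<and> (\<forall>Z\<in>F. Z \<subset> X \<longrightarrow> \<not> Y \<subset> Z)}"

lemma children_eq_lower_covers: "children V \<phi> M = lower_covers {S. strong_module V \<phi> S} M"
  unfolding children_def lower_covers_def by blast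

definition hasse_tree :: "'a set set \<Rightarrow> 'a set \<Rightarrow> 'a set tree" where
  "hasse_tree F V = \<lparr>nodes = F, root = V, arcs = {(X, Y). X \<in> F \<and> Y \<in> lower_covers F X}\<rparr>"

lemma hasse_tree_simps [simp]:
  "nodes (hasse_tree F V) = F" "root (hasse_tree F V) = V"
  "(X, Y) \<in> arcs (hasse_tree F V) \<longleftrightarrow> X \<in> F \<and> Y \<in> lower_covers F X"
  by (simp_all add: hasse_tree_def)

lemma hasse_tree_path_iff:
  assumes fin: "finite F" and X: "X \<in> F" and Y: "Y \<in> F"
  shows "(X, Y) \<in> (arcs (hasse_tree F V))\<^sup>* \<longleftrightarrow> Y \<subseteq> X"
proof
  assume "(X, Y) \<in> (arcs (hasse_tree F V))\<^sup>*"
  then show "Y \<subseteq> X" by (induction) (auto simp: lower_covers_def)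
next
  assume "Y \<subseteq> X"
  with Y show "(X, Y) \<in> (arcs (hasse_tree F V))\<^sup>*"
  proof (induction "card {Z\<in>F. Y \<subset> Z \<and> Z \<subseteq> X}" arbitrary: Y rule: less_induct)
    case less
    show ?case
    proof (cases "Y = X")
      case False
      let ?G = "{Z\<in>F. Y \<subset> Z \<and> Z \<subseteq> X}"
      have "X \<in> ?G" using less.prems X False by blast
      then obtain Z where Z: "Z \<in> ?G" "\<forall>Z'\<in>?G. Z' \<subseteq> Z \<longrightarrow> Z = Z'"
        using finite_has_minimal2[of ?G X] fin by auto
      then have "Z \<in> F" "Y \<subset> Z" "Z \<subseteq> X" by simp_all
      moreover have "{Z'\<in>F. Z \<subset> Z' \<and> Z' \<subseteq> X} \<subset> ?G" using Z(1) by blast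
      then have "card {Z'\<in>F. Z \<subset> Z' \<and> Z' \<subseteq> X} < card ?G"
        by (rule psubset_card_mono[rotated]) (use fin in simp)
      ultimately have "(X, Z) \<in> (arcs (hasse_tree F V))\<^sup>*" by (intro less.hyps)
      moreover have "Y \<in> lower_covers F Z"
        unfolding lower_covers_def
        using less.prems(1) Z(2) \<open>Y \<subset> Z\<close> \<open>Z \<subseteq> X\<close> by blast
      ultimately show ?thesis using \<open>Z \<in> F\<close> by (simp add: rtrancl_into_rtrancl)
    qed simp
  qed
qed

lemma hasse_tree_inclusion_tree:
  assumes fin: "finite F" and V: "V \<in> F" and sub: "\<And>X. X \<in> F \<Longrightarrow> X \<subseteq> V \<and> X \<noteq> {}"
    and lam: "\<And>X Y. X \<in> F \<Longrightarrow> Y \<in> F \<Longrightarrow> X \<subseteq> Y \<or> Y \<subseteq> X \<or> X \<inter> Y = {}"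
  shows "inclusion_tree (hasse_tree F V)"
proof -
  let ?T = "hasse_tree F V"
  have "\<exists>!p. (p, x) \<in> arcs ?T" if x: "x \<in> F - {V}" for x
  proof -
    have "(V, x) \<in> (arcs ?T)\<^sup>*" using hasse_tree_path_iff[OF fin V] x sub by blast
    then obtain p where p: "(p, x) \<in> arcs ?T" using x by (metis Diff_iff insertI1 rtranclE)
    have "q = p" if q: "(q, x) \<in> arcs ?T" for q
    proof -
      have pq: "p \<in> F" "q \<in> F" "x \<in> lower_covers F p" "x \<in> lower_covers F q" using p q by auto
      then have "x \<subseteq> p \<inter> q" by (auto simp: lower_covers_def)
      then have "p \<inter> q \<noteq> {}" using sub[of x] x by auto
      then have "p \<subseteq> q \<or> q \<subseteq> p" using lam[OF pq(1,2)] by blast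
      then show ?thesis using pq unfolding lower_covers_def by blast
    qed
    with p show ?thesis by blast
  qed
  moreover have "(x, V) \<notin> arcs ?T" for x using sub by (auto simp: lower_covers_def)
  moreover have "arcs ?T \<subseteq> F \<times> F" by (auto simp: lower_covers_def)
  moreover have "(V, x) \<in> (arcs ?T)\<^sup>*" if "x \<in> F" for x
    using hasse_tree_path_iff[OF fin V that] sub that by blast
  ultimately show ?thesis
    using hasse_tree_path_iff[OF fin] fin V by (simp add: inclusion_tree_def rooted_tree_def)
qed

lemma rooted_tree_reachable: "rooted_tree T \<Longrightarrow> x \<in> nodes T \<Longrightarrow> (root T, x) \<in> (arcs T)\<^sup>*"
  by (simp add: rooted_tree_def)

lemma rooted_tree_arc_nodes:
  assumes "rooted_tree T" "(x, y) \<in> arcs T"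
  shows "x \<in> nodes T" "y \<in> nodes T" "y \<noteq> root T"
proof -
  have "arcs T \<subseteq> nodes T \<times> nodes T" "\<forall>x. (x, root T) \<notin> arcs T"
    using assms(1) by (simp_all add: rooted_tree_def)
  with assms(2) show "x \<in> nodes T" "y \<in> nodes T" "y \<noteq> root T" by blast+
qed

lemma rooted_tree_parent_unique:
  assumes "rooted_tree T" "(p, x) \<in> arcs T" "(q, x) \<in> arcs T"
  shows "p = q"
proof -
  have "\<exists>!p. (p, x) \<in> arcs T"
    using assms(1) rooted_tree_arc_nodes[OF assms(1,2)] by (simp add: rooted_tree_def)
  with assms(2,3) show ?thesis by blast
qed

text \<open>
  A vertex with a loop would be its own only parent and hence unreachable from the root.
\<close>

lemma rooted_tree_no_loop:
  assumes T: "rooted_tree T" shows "(x, x) \<notin> arcs T"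
proof
  assume loop: "(x, x) \<in> arcs T"
  note x = rooted_tree_arc_nodes[OF T loop]
  have "y \<noteq> x" if "(root T, y) \<in> (arcs T)\<^sup>*" for y
    using that
  proof (induction)
    case (step y z)
    then show ?case using rooted_tree_parent_unique[OF T loop] by metis
  qed (use x in simp)
  with rooted_tree_reachable[OF T x(1)] show False by blast
qed

text \<open>
  An arc from \<open>X\<close> to \<open>Y\<close> goes to a proper subset. A node \<open>Z\<close> strictly between them would be an
  ancestor of \<open>Y\<close>, and so would contain the unique parent \<open>X\<close> of \<open>Y\<close>. Conversely, if \<open>X\<close> covers
  \<open>Y\<close>, then the last node before \<open>Y\<close> on the path from \<open>X\<close> to \<open>Y\<close> must be \<open>X\<close>.
\<close>

lemma inclusion_tree_arcs_iff:
  assumes T: "inclusion_tree T"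
  shows "(X, Y) \<in> arcs T \<longleftrightarrow> X \<in> nodes T \<and> Y \<in> lower_covers (nodes T) X"
proof -
  have rt: "rooted_tree T" and path: "\<And>X Y. X \<in> nodes T \<Longrightarrow> Y \<in> nodes T \<Longrightarrow>
      (X, Y) \<in> (arcs T)\<^sup>* \<longleftrightarrow> Y \<subseteq> X"
    using T by (auto simp: inclusion_tree_def)
  have arc: "X \<in> nodes T \<and> Y \<in> nodes T \<and> Y \<subset> X" if "(X, Y) \<in> arcs T" for X Y
  proof -
    note nodes = rooted_tree_arc_nodes(1,2)[OF rt that]
    moreover have "X \<noteq> Y" using that rooted_tree_no_loop[OF rt] by blast
    moreover have "Y \<subseteq> X" using path[OF nodes] that by blast
    ultimately show ?thesis by blast
  qed
  have parent: "\<exists>p. (p, Y) \<in> arcs T \<and> p \<subseteq> Z" if YZ: "Z \<in> nodes T" "Y \<in> nodes T" "Y \<subset> Z" for Y Z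
  proof -
    have "(Z, Y) \<in> (arcs T)\<^sup>*" using path[OF YZ(1,2)] YZ(3) by blast
    then obtain p where p: "(Z, p) \<in> (arcs T)\<^sup>*" "(p, Y) \<in> arcs T"
      using YZ(3) by (metis rtranclE less_irrefl)
    then show ?thesis using path[OF YZ(1)] rooted_tree_arc_nodes(1)[OF rt p(2)] by blast
  qed
  show ?thesis
  proof
    assume XY: "(X, Y) \<in> arcs T"
    have "\<not> Y \<subset> Z" if "Z \<in> nodes T" "Z \<subset> X" for Z
      using parent[of Z Y] that arc[OF XY] rooted_tree_parent_unique[OF rt XY] by blast
    with arc[OF XY] show "X \<in> nodes T \<and> Y \<in> lower_covers (nodes T) X"
      by (simp add: lower_covers_def)
  next
    assume *: "X \<in> nodes T \<and> Y \<in> lower_covers (nodes T) X"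
    then obtain p where p: "(p, Y) \<in> arcs T" "p \<subseteq> X"
      using parent[of X Y] by (auto simp: lower_covers_def)
    then have "p = X" using arc[OF p(1)] * unfolding lower_covers_def by blast
    with p show "(X, Y) \<in> arcs T" by simp
  qed
qed

lemma inclusion_tree_eq_hasse_tree:
  assumes T: "inclusion_tree T" and "V \<in> nodes T" and "\<And>X. X \<in> nodes T \<Longrightarrow> X \<subseteq> V"
  shows "T = hasse_tree (nodes T) V"
proof -
  have rt: "rooted_tree T" using T by (simp add: inclusion_tree_def)
  then have root: "root T \<in> nodes T" by (simp add: rooted_tree_def)
  then have "V \<subseteq> root T"
    using T rooted_tree_reachable[OF rt assms(2)] assms(2) by (simp add: inclusion_tree_def)
  with assms(3)[OF root] have "root T = V" by blast
  moreover have "arcs T = {(X, Y). X \<in> nodes T \<and> Y \<in> lower_covers (nodes T) X}"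
    using inclusion_tree_arcs_iff[OF T] by auto
  ultimately show ?thesis by (simp add: hasse_tree_def)
qed

lemma canonical_decomposition_tree_iff:
  assumes fin: "finite V" and ne: "V \<noteq> {}"
  shows "canonical_decomposition_tree V \<phi> T \<longleftrightarrow> T = hasse_tree {M. strong_module V \<phi> M} V"
proof -
  let ?F = "{M. strong_module V \<phi> M}"
  have sub: "X \<subseteq> V \<and> X \<noteq> {}" if "X \<in> ?F" for X
    using that by (simp add: strong_module_def is_module_def)
  have lam: "X \<subseteq> Y \<or> Y \<subseteq> X \<or> X \<inter> Y = {}" if "X \<in> ?F" "Y \<in> ?F" for X Y
    using that strong_module_laminar[of V \<phi> X Y] by simp
  have V: "V \<in> ?F" using strong_module_whole[OF ne] by simp
  have "finite ?F" by (rule finite_subset[of _ "Pow V"]) (use fin sub in auto)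
  then have "inclusion_tree (hasse_tree ?F V)"
    using V sub lam by (rule hasse_tree_inclusion_tree)
  then have "canonical_decomposition_tree V \<phi> (hasse_tree ?F V)"
    by (simp add: canonical_decomposition_tree_def)
  moreover have "T = hasse_tree ?F V" if T: "canonical_decomposition_tree V \<phi> T"
  proof -
    have "inclusion_tree T" and nodes: "nodes T = ?F"
      using T by (simp_all add: canonical_decomposition_tree_def)
    then show ?thesis using inclusion_tree_eq_hasse_tree[of T V] V sub unfolding nodes by blast
  qed
  ultimately show ?thesis by blast
qed

section \<open>The canonical modular decomposition\<close>

theorem corollary4p3:
  fixes d :: nat and V :: "'a set" and \<phi> :: "'a set \<Rightarrow> nat"
  assumes "d \<ge> 2" and "cis_d_graph d V \<phi>"
  shows "(\<exists>!T. canonical_decomposition_tree V \<phi> T) \<and>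
    (\<forall>T. canonical_decomposition_tree V \<phi> T \<longrightarrow>
       root T = V \<and>
       leaves T = {{v} | v. v \<in> V} \<and>
       (\<forall>M\<in>nodes T. \<not> is_singleton M \<longrightarrow>
          arcs T `` {M} = children V \<phi> M \<and>
          partition_on M (children V \<phi> M) \<and>
          (\<forall>A\<in>children V \<phi> M. \<forall>B\<in>children V \<phi> M. A \<noteq> B \<longrightarrow>
             (\<exists>c. \<forall>a\<in>A. \<forall>b\<in>B. \<phi> {a, b} = c)) \<and>
          cis_d_graph d (children V \<phi> M) (quotient_coloring \<phi>) \<and>
          card (colors_used (children V \<phi> M) (quotient_coloring \<phi>)) \<le> 2))"
proof -
  let ?T = "hasse_tree {M. strong_module V \<phi> M} V"
  have d: "1 \<le> d" using assms(1) by simp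
  have fin: "finite V" using assms(2) by (simp add: cis_d_graph_def d_graph_def)
  have ne: "V \<noteq> {}"
    using cis_common_extension[OF d assms(2), of "\<lambda>_. {}"] by (auto simp: avoids_empty)
  note tree_iff = canonical_decomposition_tree_iff[OF fin ne]
  have arcs: "arcs ?T `` {M} = children V \<phi> M" if "strong_module V \<phi> M" for M
    using that by (auto simp: children_eq_lower_covers)
  note part = children_module_partition[OF fin]
  have "leaves ?T = {{v} | v. v \<in> V}"
  proof (intro equalityI subsetI)
    fix M assume "M \<in> leaves ?T"
    then have M: "strong_module V \<phi> M" "children V \<phi> M = {}"
      using arcs by (auto simp: leaves_def)
    have "M \<subseteq> V" "M \<noteq> {}" using M by (auto simp: strong_module_def is_module_def)
    moreover have "is_singleton M"
      using module_partition_Union[OF part[OF M(1)]] M(2) \<open>M \<noteq> {}\<close> by auto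
    ultimately show "M \<in> {{v} | v. v \<in> V}" by (auto simp: is_singleton_def)
  next
    fix M assume "M \<in> {{v} | v. v \<in> V}"
    then obtain v where v: "M = {v}" "v \<in> V" by blast
    have "C \<noteq> {}" if "strong_module V \<phi> C" for C
      using that by (simp add: strong_module_def is_module_def)
    moreover have "C = {}" if "C \<subset> {v}" for C using that by blast
    ultimately have "children V \<phi> M = {}" unfolding v children_def by auto
    then show "M \<in> leaves ?T"
      using strong_module_singleton[OF v(2)] arcs[of M] v by (simp add: leaves_def)
  qed
  moreover have "partition_on M (children V \<phi> M) \<and>
      (\<forall>A\<in>children V \<phi> M. \<forall>B\<in>children V \<phi> M. A \<noteq> B \<longrightarrow>
         (\<exists>c. \<forall>a\<in>A. \<forall>b\<in>B. \<phi> {a, b} = c)) \<and>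
      cis_d_graph d (children V \<phi> M) (quotient_coloring \<phi>) \<and>
      card (colors_used (children V \<phi> M) (quotient_coloring \<phi>)) \<le> 2"
    if M: "strong_module V \<phi> M" "\<not> is_singleton M" for M
  proof (intro conjI ballI impI)
    note P = part[OF M]
    show "partition_on M (children V \<phi> M)" using P by (simp add: module_partition_def)
    show cisQ: "cis_d_graph d (children V \<phi> M) (quotient_coloring \<phi>)"
      by (rule cis_quotient[OF d assms(2) P])
    show "card (colors_used (children V \<phi> M) (quotient_coloring \<phi>)) \<le> 2"
      by (rule quotient_at_most_two_colors[OF fin M cis_rainbow_free[OF d cisQ]])
    fix A B assume "A \<in> children V \<phi> M" "B \<in> children V \<phi> M" "A \<noteq> B"
    then have "\<forall>a\<in>A. \<forall>b\<in>B. \<phi> {a, b} = quotient_coloring \<phi> {A, B}"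
      using quotient_coloring_eq[OF P] by simp
    then show "\<exists>c. \<forall>a\<in>A. \<forall>b\<in>B. \<phi> {a, b} = c" ..
  qed
  ultimately show ?thesis unfolding tree_iff using arcs by simp
qed

end
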